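(* There exist a dendrite $Y$ with a metric $\rho$ and a continuous map $F:Y\to Y$ such that the dynamical system $(Y,\rho,F)$ is DC3 chaotic but not Li-Yorke chaotic.
   Context: A dendrite is a locally connected continuum (compact connected metric space) containing no subspace homeomorphic to the circle. A dynamical system is a triple $(X,d,f)$ with $(X,d)$ a compact metric space and $f:X\to X$ continuous. A pair $x,y\in X$ is a Li-Yorke pair if $\liminf_{i\to\infty} d(f^i(x),f^i(y))=0$ and $\limsup_{i\to\infty} d(f^i(x),f^i(y))>0$. The lower and upper distribution functions of $x,y$ are $$\Phi_{x,y}(s)=\liminf_{n\to\infty} \tfrac1n \#\{i\le n : d(f^i(x),f^i(y))<s\},\qquad \Phi^*_{x,y}(s)=\limsup_{n\to\infty} \tfrac1n \#\{i\le n : d(f^i(x),f^i(y))<s\}.$$ The pair $x,y$ is a DC3 pair if there exist real numbers $a<b$ such that $\Phi_{x,y}(s)<\Phi^*_{x,y}(s)$ for all $s\in[a,b]$. A set $S\subset X$ is Li-Yorke scrambled (resp. DC3 scrambled) if every pair $x,y\in S$ with $x\ne y$ is a Li-Yorke pair (resp. DC3 pair). The system is Li-Yorke chaotic (resp. DC3 chaotic) if it has an uncountable Li-Yorke scrambled (resp. DC3 scrambled) set. *)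

theory Defs
  imports "HOL-Analysis.Analysis"
begin

text \<open>The notions concern a metric \<open>d\<close> on a carrier set \<open>X\<close>, in the sense of the locale
  \<open>Metric_space\<close>; its topology is \<open>Metric_space.mtopology X d\<close>. Self-maps of \<open>X\<close> are total
  functions whose values outside \<open>X\<close> play no role.\<close>

definition continuum :: "'a set \<Rightarrow> ('a \<Rightarrow> 'a \<Rightarrow> real) \<Rightarrow> bool" where
  "continuum X d \<longleftrightarrow>
     Metric_space X d \<and> X \<noteq> {} \<and>
     compact_space (Metric_space.mtopology X d) \<and>
     connected_space (Metric_space.mtopology X d)"

definition dendrite :: "'a set \<Rightarrow> ('a \<Rightarrow> 'a \<Rightarrow> real) \<Rightarrow> bool" where
  "dendrite X d \<longleftrightarrow>
     continuum X d \<and>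
     locally_connected_space (Metric_space.mtopology X d) \<and>
     \<not> (\<exists>C \<subseteq> X. subtopology (Metric_space.mtopology X d) C
                  homeomorphic_space top_of_set (sphere (0::complex) 1))"

definition dynamical_system ::
    "'a set \<Rightarrow> ('a \<Rightarrow> 'a \<Rightarrow> real) \<Rightarrow> ('a \<Rightarrow> 'a) \<Rightarrow> bool" where
  "dynamical_system X d f \<longleftrightarrow>
     Metric_space X d \<and>
     compact_space (Metric_space.mtopology X d) \<and>
     continuous_map (Metric_space.mtopology X d) (Metric_space.mtopology X d) f"

definition li_yorke_pair ::
    "('a \<Rightarrow> 'a \<Rightarrow> real) \<Rightarrow> ('a \<Rightarrow> 'a) \<Rightarrow> 'a \<Rightarrow> 'a \<Rightarrow> bool" where
  "li_yorke_pair d f x y \<longleftrightarrow>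
     liminf (\<lambda>i. ereal (d ((f ^^ i) x) ((f ^^ i) y))) = 0 \<and>
     limsup (\<lambda>i. ereal (d ((f ^^ i) x) ((f ^^ i) y))) > 0"

text \<open>Both distribution functions take values in the unit interval; \<open>ereal\<close> is used only because
  \<open>liminf\<close> and \<open>limsup\<close> require a complete order. The term for \<open>n = 0\<close> is \<open>0\<close> and does not
  affect the limits.\<close>

definition lower_distr ::
    "('a \<Rightarrow> 'a \<Rightarrow> real) \<Rightarrow> ('a \<Rightarrow> 'a) \<Rightarrow> 'a \<Rightarrow> 'a \<Rightarrow> real \<Rightarrow> ereal" where
  "lower_distr d f x y s =
     liminf (\<lambda>n. ereal (1 / real n * real (card {i. i \<le> n \<and> d ((f ^^ i) x) ((f ^^ i) y) < s})))"

definition upper_distr ::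
    "('a \<Rightarrow> 'a \<Rightarrow> real) \<Rightarrow> ('a \<Rightarrow> 'a) \<Rightarrow> 'a \<Rightarrow> 'a \<Rightarrow> real \<Rightarrow> ereal" where
  "upper_distr d f x y s =
     limsup (\<lambda>n. ereal (1 / real n * real (card {i. i \<le> n \<and> d ((f ^^ i) x) ((f ^^ i) y) < s})))"

definition DC3_pair ::
    "('a \<Rightarrow> 'a \<Rightarrow> real) \<Rightarrow> ('a \<Rightarrow> 'a) \<Rightarrow> 'a \<Rightarrow> 'a \<Rightarrow> bool" where
  "DC3_pair d f x y \<longleftrightarrow>
     (\<exists>a b. a < b \<and> (\<forall>s\<in>{a..b}. lower_distr d f x y s < upper_distr d f x y s))"

definition li_yorke_scrambled ::
    "'a set \<Rightarrow> ('a \<Rightarrow> 'a \<Rightarrow> real) \<Rightarrow> ('a \<Rightarrow> 'a) \<Rightarrow> 'a set \<Rightarrow> bool" where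
  "li_yorke_scrambled X d f S \<longleftrightarrow>
     S \<subseteq> X \<and> (\<forall>x\<in>S. \<forall>y\<in>S. x \<noteq> y \<longrightarrow> li_yorke_pair d f x y)"

definition DC3_scrambled ::
    "'a set \<Rightarrow> ('a \<Rightarrow> 'a \<Rightarrow> real) \<Rightarrow> ('a \<Rightarrow> 'a) \<Rightarrow> 'a set \<Rightarrow> bool" where
  "DC3_scrambled X d f S \<longleftrightarrow>
     S \<subseteq> X \<and> (\<forall>x\<in>S. \<forall>y\<in>S. x \<noteq> y \<longrightarrow> DC3_pair d f x y)"

definition li_yorke_chaotic ::
    "'a set \<Rightarrow> ('a \<Rightarrow> 'a \<Rightarrow> real) \<Rightarrow> ('a \<Rightarrow> 'a) \<Rightarrow> bool" where
  "li_yorke_chaotic X d f \<longleftrightarrow> (\<exists>S. uncountable S \<and> li_yorke_scrambled X d f S)"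

definition DC3_chaotic ::
    "'a set \<Rightarrow> ('a \<Rightarrow> 'a \<Rightarrow> real) \<Rightarrow> ('a \<Rightarrow> 'a) \<Rightarrow> bool" where
  "DC3_chaotic X d f \<longleftrightarrow> (\<exists>S. uncountable S \<and> DC3_scrambled X d f S)"

text \<open>Existence statements about compact metric spaces are made for carriers of type
  \<open>(nat \<Rightarrow> real) set\<close>, with an arbitrary metric unrelated to the type's own structure. This is no
  restriction: a compact metric space has at most continuum many points, so it is isometric to
  such a carrier.\<close>

end

theory Submission
  imports Defs
begin

text \<open>The endpoints of the dendrite are certain sign sequences whose even entries \<open>c\<close> are fixed by
  the map and whose odd entries \<open>u\<close> are shifted. To every \<open>c\<close> belongs one word \<open>word c\<close>, constant on
  the blocks \<open>{4^j..<4^(j+1)}\<close>: every other block carries the sign \<open>1\<close>, the remaining ones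
  carry signs read off from \<open>c\<close>, each infinitely often. The odd part \<open>u\<close> is a shift of \<open>word c\<close>, or a
  limit of such shifts, that is, a sequence with at most one change of sign. Hence only countably
  many endpoints share the same \<open>c\<close>, while endpoints with different \<open>c\<close> stay a definite distance
  apart forever, so no uncountable set is Li-Yorke scrambled. If \<open>c \<noteq> c'\<close>, however, then
  \<open>word c\<close> and \<open>word c'\<close> agree on infinitely many blocks and disagree on infinitely many, and a
  block makes up three quarters of the time elapsed at its end; this gives DC3 pairs.

  The interior of the dendrite consists of the truncations of endpoints
  \<open>(\<plusminus>1, \<dots>, \<plusminus>1, r, 0, 0, \<dots>)\<close> with \<open>\<bar>r\<bar> \<le> 1\<close>. The map shortens them by two entries, so
  they all reach the zero sequence and contribute no Li-Yorke pairs among themselves.\<close>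

section \<open>Downward closed subsets of the tree\<close>

text \<open>The infinite binary tree together with its ends: coordinate \<open>n\<close> runs from 0
  to 1 or to -1 along one of the two edges that leave a vertex of depth \<open>n\<close>.\<close>

definition tree :: "(nat \<Rightarrow> real) set" where
  "tree = {y. \<forall>n. \<bar>y n\<bar> \<le> 1 \<and> (y (Suc n) \<noteq> 0 \<longrightarrow> \<bar>y n\<bar> = 1)}"

text \<open>\<open>below z y\<close> says that \<open>z\<close> lies on the arc of \<^const>\<open>tree\<close> from the root \<open>0\<close> to \<open>y\<close>.\<close>

definition below :: "(nat \<Rightarrow> real) \<Rightarrow> (nat \<Rightarrow> real) \<Rightarrow> bool" where
  "below z y \<longleftrightarrow> (\<forall>i. 0 \<le> z i * y i \<and> \<bar>z i\<bar> \<le> \<bar>y i\<bar>)"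

text \<open>Coordinate \<open>i\<close> is switched on while \<open>s\<close> falls from
  \<open>2 / 2^i\<close> to \<open>1 / 2^i\<close>. The coordinates thus come one after another, and
  infinitely many fit into the parameter interval from 0 to 2.\<close>

definition ramp :: "nat \<Rightarrow> real \<Rightarrow> real" where
  "ramp i s = max 0 (min 1 (2 - 2 ^ i * s))"

lemma tree_abs_le: "y \<in> tree \<Longrightarrow> \<bar>y n\<bar> \<le> 1"
  by (simp add: tree_def)

lemma tree_Suc: "y \<in> tree \<Longrightarrow> y (Suc n) \<noteq> 0 \<Longrightarrow> \<bar>y n\<bar> = 1"
  by (simp add: tree_def)

lemma tree_less:
  assumes "y \<in> tree" "y n \<noteq> 0" "i < n"
  shows "\<bar>y i\<bar> = 1"
  using assms(3,2)
proof (induction n rule: less_Suc_induct)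
  case (1 n)
  then show ?case using assms(1) tree_Suc by blast
next
  case (2 i j k)
  then show ?case by force
qed

lemma zero_in_tree: "(\<lambda>_. 0) \<in> tree"
  by (simp add: tree_def)

lemma below_refl: "below y y"
  by (simp add: below_def)

lemma below_trans: "below x y \<Longrightarrow> below y z \<Longrightarrow> below x z"
  unfolding below_def
  by (smt (verit, ccfv_threshold) mult_eq_0_iff zero_le_mult_iff)

lemma ramp_bounds: "0 \<le> ramp i s" "ramp i s \<le> 1"
  by (auto simp: ramp_def)

lemma ramp_0: "ramp i 0 = 1"
  by (simp add: ramp_def)

lemma ramp_2: "ramp i 2 = 0"
proof -
  have "(1::real) \<le> 2 ^ i" by simp
  then show ?thesis unfolding ramp_def by linarith
qed

lemma ramp_Suc: "ramp (Suc i) s \<noteq> 0 \<Longrightarrow> ramp i s = 1"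
  by (auto simp: ramp_def max_def min_def split: if_splits)

text \<open>As \<open>s\<close> falls from 2 to 0, the path \<open>p\<close> starts at
  \<open>m\<close> and fills in the coordinates of \<open>z\<close> in turn. This works even if
  \<open>z\<close> is an end, infinitely many edges away from \<open>m\<close>.\<close>

lemma connected_order_interval:
  assumes m: "m \<in> tree" and z: "z \<in> tree" and mz: "below m z"
  shows "\<exists>C. connected C \<and> m \<in> C \<and> z \<in> C \<and> C \<subseteq> {p \<in> tree. below m p \<and> below p z}"
proof -
  define p where "p = (\<lambda>s i. m i + (z i - m i) * ramp i s)"
  have "continuous_on {0..2} p"
    unfolding p_def ramp_def by (intro continuous_intros)
  then have "connected (p ` {0..2})"
    by (simp add: connected_continuous_image)
  moreover have "p 0 = z" "p 2 = m"
    by (auto simp: p_def ramp_0 ramp_2)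
  moreover have "p s \<in> tree \<and> below m (p s) \<and> below (p s) z" for s
  proof -
    have *: "0 \<le> m i * p s i \<and> \<bar>m i\<bar> \<le> \<bar>p s i\<bar> \<and> 0 \<le> p s i * z i \<and> \<bar>p s i\<bar> \<le> \<bar>z i\<bar>" for i
    proof -
      have b: "0 \<le> m i * z i" "\<bar>m i\<bar> \<le> \<bar>z i\<bar>"
        using mz by (auto simp: below_def)
      let ?t = "ramp i s"
      have t: "0 \<le> ?t" "?t \<le> 1" by (rule ramp_bounds)+
      show ?thesis
      proof (cases "0 \<le> z i")
        case True
        with b have "0 \<le> m i" "m i \<le> z i"
          by (auto simp: zero_le_mult_iff abs_if split: if_splits)
        moreover have "0 \<le> (z i - m i) * ?t" "(z i - m i) * ?t \<le> (z i - m i) * 1"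
          using t \<open>m i \<le> z i\<close> by (auto intro!: mult_nonneg_nonneg mult_left_le)
        ultimately show ?thesis using True by (auto simp: p_def)
      next
        case False
        with b have "m i \<le> 0" "z i \<le> m i"
          by (auto simp: zero_le_mult_iff abs_if split: if_splits)
        moreover have "0 \<le> (m i - z i) * ?t" "(m i - z i) * ?t \<le> (m i - z i) * 1"
          using t \<open>z i \<le> m i\<close> by (auto intro!: mult_nonneg_nonneg mult_left_le)
        ultimately have "m i \<le> 0" "p s i \<le> m i" "z i \<le> p s i" by (auto simp: p_def algebra_simps)
        then show ?thesis using False by (auto intro: mult_nonpos_nonpos)
      qed
    qed
    \<comment> \<open>If coordinate \<open>Suc i\<close> comes from \<open>z\<close> alone, its ramp
      is nonzero, so the ramp of \<open>i\<close> has already reached 1. Otherwise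
      \<open>m i\<close> is already a sign, and \<open>p s i\<close> is squeezed between
      \<open>m i\<close> and \<open>z i\<close>.\<close>
    have "\<bar>p s i\<bar> = 1" if "p s (Suc i) \<noteq> 0" for i
    proof (cases "m (Suc i) = 0")
      case True
      with that have "z (Suc i) \<noteq> 0" "ramp (Suc i) s \<noteq> 0" by (auto simp: p_def)
      then show ?thesis using z ramp_Suc tree_Suc by (simp add: p_def)
    next
      case False
      then have "\<bar>m i\<bar> = 1" using m tree_Suc by blast
      then show ?thesis using * z tree_abs_le by (smt (verit))
    qed
    with * show ?thesis using tree_abs_le[OF z] by (fastforce simp: tree_def below_def intro: order_trans)
  qed
  ultimately show ?thesis
    by (intro exI[of _ "p ` {0..2}"]) (force simp: image_iff)
qed

lemma compact_tree: "compact tree"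
proof -
  have "compact (PiE UNIV (\<lambda>_::nat. {-1..1::real}))"
    by (metis compactin_PiE compactin_euclidean_iff compact_Icc euclidean_product_topology)
  moreover have "closed tree"
  proof -
    \<comment> \<open>The implication becomes a vanishing product, which is visibly a closed
      condition.\<close>
    have "tree = (\<Inter>n. {y. \<bar>y n\<bar> \<le> 1} \<inter> {y. y (Suc n) * (1 - \<bar>y n\<bar>) = 0})"
      by (auto simp: tree_def)
    moreover have "closed (\<Inter>n::nat. {y. \<bar>y n\<bar> \<le> (1::real)} \<inter> {y. y (Suc n) * (1 - \<bar>y n\<bar>) = 0})"
      by (intro closed_INT ballI closed_Int closed_Collect_le closed_Collect_eq continuous_intros
          continuous_on_product_coordinates)
    ultimately show ?thesis by metis
  qed
  moreover have "tree \<subseteq> PiE UNIV (\<lambda>_. {-1..1})"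
    by (auto simp: tree_def PiE_def abs_le_iff minus_le_iff)
  ultimately show ?thesis
    by (metis compact_Int_closed inf.absorb_iff2)
qed

text \<open>The dendrite will be the part of the tree under a chosen set of ends. All that it needs,
  apart from compactness, is proved for every set that contains the arcs from the root to its
  points.\<close>

definition downclosed :: "(nat \<Rightarrow> real) set \<Rightarrow> bool" where
  "downclosed Y \<longleftrightarrow> Y \<subseteq> tree \<and> (\<forall>y\<in>Y. \<forall>z\<in>tree. below z y \<longrightarrow> z \<in> Y)"

lemma connected_downclosed:
  assumes "downclosed Y"
  shows "connected Y"
proof -
  have "connected_component Y (\<lambda>_. 0) y" if "y \<in> Y" for y
  proof -
    have "y \<in> tree" using that assms by (auto simp: downclosed_def)
    moreover have "below (\<lambda>_. 0) y" by (simp add: below_def)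
    ultimately obtain C where "connected C" "(\<lambda>_. 0) \<in> C" "y \<in> C"
        "C \<subseteq> {p \<in> tree. below (\<lambda>_. 0) p \<and> below p y}"
      using connected_order_interval[OF zero_in_tree] by blast
    moreover have "{p \<in> tree. below (\<lambda>_. 0) p \<and> below p y} \<subseteq> Y"
      using assms that by (auto simp: downclosed_def)
    ultimately show ?thesis unfolding connected_component_def by blast
  qed
  then show ?thesis
    unfolding connected_iff_connected_component
    by (meson connected_component_sym connected_component_trans)
qed

text \<open>It suffices to join each \<open>z\<close> near \<open>w\<close> to \<open>w\<close> by a
  connected subset of \<open>V\<close>. The arcs from \<open>z\<close> and from \<open>w\<close> to
  their branch point serve: in the finitely many coordinates that a basic neighbourhood restricts,
  no point of these arcs is farther from \<open>w\<close> than \<open>z\<close> is.\<close>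

lemma locally_connected_downclosed:
  assumes "downclosed Y"
  shows "locally_connected_space (top_of_set Y)"
  unfolding locally_connected_space_im_kleinen
proof (intro allI impI, elim conjE)
  fix V w assume V: "openin (top_of_set Y) V" and w: "w \<in> V"
  have Yt: "Y \<subseteq> tree" and down: "\<And>y z. y \<in> Y \<Longrightarrow> z \<in> tree \<Longrightarrow> below z y \<Longrightarrow> z \<in> Y"
    using assms by (auto simp: downclosed_def)
  obtain O' where O': "open O'" "V = Y \<inter> O'" using V by (auto simp: openin_open)
  obtain X where X: "w \<in> PiE UNIV X" "\<And>i. open (X i)" "finite {i. X i \<noteq> UNIV}" "PiE UNIV X \<subseteq> O'"
    using product_topology_open_contains_basis[of "\<lambda>_::nat. euclideanreal" UNIV O' w] O' w
    by (auto simp: euclidean_product_topology)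
  have "\<exists>e>0. ball (w i) e \<subseteq> X i" for i
    using X(1,2) open_contains_ball by (metis PiE_iff UNIV_I)
  then obtain e where e: "\<And>i. e i > 0" "\<And>i. ball (w i) (e i) \<subseteq> X i" by metis
  obtain N where N: "\<And>i. X i \<noteq> UNIV \<Longrightarrow> i \<le> N"
    using X(3) finite_nat_set_iff_bounded_le by auto
  \<comment> \<open>The bound 1 excludes that \<open>z\<close> and \<open>w\<close> have opposite
    signs of absolute value 1 in one of these coordinates.\<close>
  define U where "U = Y \<inter> (\<Inter>i\<in>{..N}. {z. \<bar>z i - w i\<bar> < min 1 (e i)})"
  have U': "open (\<Inter>i\<in>{..N}. {z. \<bar>z i - w i\<bar> < min 1 (e i)})"
    by (intro open_INT ballI open_Collect_less continuous_intros continuous_on_product_coordinates) auto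
  have inV: "p \<in> V" if "p \<in> Y" "z \<in> U" "\<And>i. i \<le> N \<Longrightarrow> \<bar>p i - w i\<bar> \<le> \<bar>z i - w i\<bar>" for p z
  proof -
    have "p i \<in> X i" for i
    proof (cases "i \<le> N")
      case True
      then have "p i \<in> ball (w i) (e i)" using that by (force simp: U_def dist_real_def)
      then show ?thesis using e(2) by blast
    next
      case False then show ?thesis using N by auto
    qed
    then show ?thesis using X(4) O'(2) that(1) by auto
  qed
  have "\<exists>C. connectedin (top_of_set Y) C \<and> C \<subseteq> V \<and> w \<in> C \<and> z \<in> C" if zU: "z \<in> U" for z
  proof -
    have zY: "z \<in> Y" and wY: "w \<in> Y" and zt: "z \<in> tree" and wt: "w \<in> tree"
      using zU w O' Yt by (auto simp: U_def)
    \<comment> \<open>the branch point of \<open>z\<close> and \<open>w\<close>\<close>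
    define m where "m = (\<lambda>i. if \<forall>j<i. z j = w j
      then max 0 (min (z i) (w i)) + min 0 (max (z i) (w i)) else 0)"
    have mz: "below m z" and mw: "below m w"
      by (auto simp: below_def m_def max_def min_def mult_nonpos_nonpos split: if_splits)
    have mt: "m \<in> tree"
    proof -
      have "\<bar>m i\<bar> \<le> 1" for i
        using mz tree_abs_le[OF zt, of i] by (auto simp: below_def intro: order_trans)
      moreover have "\<bar>m i\<bar> = 1" if "m (Suc i) \<noteq> 0" for i
      proof -
        have "\<forall>j<Suc i. z j = w j" using that by (auto simp: m_def split: if_splits)
        moreover have "z (Suc i) \<noteq> 0" using that mz by (metis abs_le_zero_iff abs_zero below_def)
        then have "\<bar>z i\<bar> = 1" using zt tree_Suc by blast
        ultimately show ?thesis by (auto simp: m_def max_def min_def)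
      qed
      ultimately show ?thesis by (auto simp: tree_def)
    qed
    \<comment> \<open>If \<open>z\<close> and \<open>w\<close> differ at some \<open>j < i\<close>,
      they are not both signs there, so one of them has stopped before coordinate
      \<open>i\<close>.\<close>
    have mcl: "\<bar>m i - w i\<bar> \<le> \<bar>z i - w i\<bar>" if "i \<le> N" for i
    proof (cases "\<forall>j<i. z j = w j")
      case True
      then show ?thesis by (auto simp: m_def max_def min_def)
    next
      case False
      then obtain j where j: "j < i" "z j \<noteq> w j" by auto
      have "z i = 0 \<or> w i = 0"
      proof (rule ccontr)
        assume "\<not> (z i = 0 \<or> w i = 0)"
        then have "\<bar>z j\<bar> = 1" "\<bar>w j\<bar> = 1" using tree_less zt wt j by blast+
        moreover have "\<bar>z j - w j\<bar> < 1" using zU j that by (auto simp: U_def)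
        ultimately show False using j by (auto simp: abs_if split: if_splits)
      qed
      moreover have "m i = 0" using False by (auto simp: m_def)
      ultimately show ?thesis by auto
    qed
    obtain C where C: "connected C" "m \<in> C" "z \<in> C" "C \<subseteq> {p \<in> tree. below m p \<and> below p z}"
      using connected_order_interval[OF mt zt mz] by blast
    obtain D where D: "connected D" "m \<in> D" "w \<in> D" "D \<subseteq> {p \<in> tree. below m p \<and> below p w}"
      using connected_order_interval[OF mt wt mw] by blast
    have between: "\<bar>p i - w i\<bar> \<le> max \<bar>m i - w i\<bar> \<bar>z' i - w i\<bar>" if "below m p" "below p z'" for p z' i
    proof -
      have "0 \<le> m i * p i" "\<bar>m i\<bar> \<le> \<bar>p i\<bar>" "0 \<le> p i * z' i" "\<bar>p i\<bar> \<le> \<bar>z' i\<bar>"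
        using that by (auto simp: below_def)
      then have "(m i \<le> p i \<and> p i \<le> z' i) \<or> (z' i \<le> p i \<and> p i \<le> m i)"
        by (auto simp: zero_le_mult_iff abs_if split: if_splits)
      then show ?thesis by auto
    qed
    have "C \<subseteq> V"
    proof
      fix p assume "p \<in> C"
      then have "below m p" "below p z" "p \<in> Y" using C(4) down[OF zY] by auto
      moreover have "\<bar>p i - w i\<bar> \<le> \<bar>z i - w i\<bar>" if "i \<le> N" for i
        using between[OF \<open>below m p\<close> \<open>below p z\<close>, of i] mcl[OF that] by linarith
      ultimately show "p \<in> V" using inV zU by blast
    qed
    moreover have "D \<subseteq> V"
    proof
      fix p assume "p \<in> D"
      then have "below m p" "below p w" "p \<in> Y" using D(4) down[OF wY] by auto
      moreover have "\<bar>p i - w i\<bar> \<le> \<bar>z i - w i\<bar>" if "i \<le> N" for i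
        using between[OF \<open>below m p\<close> \<open>below p w\<close>, of i] mcl[OF that] by linarith
      ultimately show "p \<in> V" using inV zU by blast
    qed
    moreover have "connected (C \<union> D)" using C D by (intro connected_Un) auto
    ultimately show ?thesis
      using C D O' by (intro exI[of _ "C \<union> D"]) (auto simp: connectedin_subtopology)
  qed
  moreover have "openin (top_of_set Y) U" using U' by (auto simp: U_def openin_open)
  moreover have "w \<in> U" using w O' e(1) by (auto simp: U_def)
  moreover have "U \<subseteq> V" using inV by (auto simp: U_def)
  ultimately show "\<exists>U. openin (top_of_set Y) U \<and> w \<in> U \<and> U \<subseteq> V \<and>
      (\<forall>y\<in>U. \<exists>C. connectedin (top_of_set Y) C \<and> C \<subseteq> V \<and> w \<in> C \<and> y \<in> C)"
    by blast
qed

section \<open>Cut points and the absence of circles\<close>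

lemma connected_punctured_circle: "connected (sphere (0::complex) 1 - {b})"
proof (cases "b \<in> sphere (0::complex) 1")
  case True
  \<comment> \<open>Stereographic projection onto a line; the normal vector need only be
    nonzero.\<close>
  have "(sphere (0::complex) 1 - {b}) homeomorphic {x::complex. \<i> \<bullet> x = 0}"
    using True by (intro homeomorphic_punctured_sphere_hyperplane) auto
  moreover have "connected {x::complex. \<i> \<bullet> x = 0}"
    by (rule convex_connected[OF convex_hyperplane])
  ultimately show ?thesis using homeomorphic_connectedness by blast
qed (simp add: connected_sphere)

text \<open>Two points of \<open>C\<close> that first differ at coordinate \<open>n\<close> are
  separated by a suitable point \<open>q\<close> of an edge at that coordinate. Whether or not
  \<open>q\<close> lies in \<open>C\<close>, this contradicts the connectedness of
  \<open>C - {q}\<close>.\<close>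

lemma no_circle_in_tree:
  assumes "C \<subseteq> tree"
  shows "\<not> C homeomorphic sphere (0::complex) 1"
proof
  assume "C homeomorphic sphere (0::complex) 1"
  then obtain f g where hom: "homeomorphism C (sphere (0::complex) 1) f g"
    by (auto simp: homeomorphic_def)
  have C_minus: "connected (C - {q})" if "q \<in> C" for q
  proof -
    have "connected (g ` (sphere 0 1 - {f q}))"
      using hom by (intro connected_continuous_image connected_punctured_circle)
        (auto simp: homeomorphism_def intro: continuous_on_subset)
    moreover have "g ` (sphere 0 1 - {f q}) = C - {q}"
      using hom that unfolding homeomorphism_def by (auto simp: image_iff)
    ultimately show ?thesis by simp
  qed
  have C: "connected C"
    using hom connected_sphere[where 'a=complex] homeomorphic_connectedness homeomorphic_def
    by (metis DIM_complex order_refl)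
  \<comment> \<open>The point \<open>q\<close> below would separate \<open>C\<close>, but a circle has no cut point.\<close>
  have sep: False if y: "y \<in> C" and z: "z \<in> C" and pre: "\<And>i. i < n \<Longrightarrow> y i = z i"
     and s: "s = 1 \<or> s = -1" and v: "0 < v" "s * z n < v" "v < s * y n" for y z n s v
  proof -
    have yt: "y \<in> tree" using y assms by auto
    have yn: "y n \<noteq> 0" using v by auto
    have y1: "\<bar>y i\<bar> = 1" if "i < n" for i using tree_less[OF yt yn that] .
    have v1: "v < 1" using tree_abs_le[OF yt, of n] s v by auto
    define q where "q = (\<lambda>i. if i < n then y i else if i = n then s * v else 0)"
    \<comment> \<open>Within \<open>tree\<close>, the open set \<open>A\<close> and the closed set
      \<open>B\<close> differ at most by \<open>q\<close>: both describe what lies beyond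
      \<open>q\<close> as seen from the root. Hence this part is open and closed once
      \<open>q\<close> is removed.\<close>
    define A where "A = (\<Inter>i\<in>{..<n}. {w. 0 < w i * y i}) \<inter> {w. v < s * w n}"
    define B where "B = (\<Inter>i\<in>{..<n}. {w. 1 \<le> w i * y i}) \<inter> {w. v \<le> s * w n}"
    have "open A" unfolding A_def
      by (intro open_Int open_INT ballI open_Collect_less continuous_intros continuous_on_product_coordinates) auto
    have "closed B" unfolding B_def
      by (intro closed_Int closed_INT ballI closed_Collect_le continuous_intros continuous_on_product_coordinates)
    have BA: "w = q \<or> w \<in> A" if "w \<in> tree" "w \<in> B" for w
    proof (cases "v < s * w n")
      case True
      moreover have "0 < w i * y i" if "i < n" for i
        using \<open>w \<in> B\<close> that by (auto simp: B_def intro: less_le_trans[OF zero_less_one])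
      ultimately show ?thesis by (auto simp: A_def)
    next
      case False
      then have sv: "s * w n = v" using that by (auto simp: B_def)
      then have wn: "w n = s * v" using s by auto
      have "w i = y i" if "i < n" for i
      proof -
        have "\<bar>w i\<bar> \<le> 1" "1 \<le> w i * y i" using tree_abs_le \<open>w \<in> tree\<close> \<open>w \<in> B\<close> that by (auto simp: B_def)
        then show ?thesis using y1[OF that] by (auto simp: abs_if split: if_splits)
      qed
      moreover have "w i = 0" if "n < i" for i
      proof (rule ccontr)
        assume "w i \<noteq> 0"
        then have "\<bar>w n\<bar> = 1" using tree_less[OF \<open>w \<in> tree\<close> _ that] by blast
        then show False using wn v(1) v1 s by auto
      qed
      ultimately show ?thesis using wn by (auto simp: q_def fun_eq_iff)
    qed
    have AB: "w \<in> B" if "w \<in> tree" "w \<in> A" for w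
    proof -
      have "w n \<noteq> 0" using that v by (auto simp: A_def)
      then have "\<bar>w i\<bar> = 1" if "i < n" for i using tree_less \<open>w \<in> tree\<close> that by blast
      then have "\<bar>w i * y i\<bar> = 1" if "i < n" for i using y1 that by (simp add: abs_mult)
      moreover have "0 < w i * y i" if "i < n" for i
        using \<open>w \<in> A\<close> that by (auto simp: A_def)
      ultimately have "w i * y i = 1" if "i < n" for i
        by (metis abs_of_pos that)
      then show ?thesis using \<open>w \<in> A\<close> by (auto simp: A_def B_def)
    qed
    have qA: "q \<notin> A" using s by (auto simp: A_def q_def)
    have yA: "y \<in> A" using v y1 by (auto simp: A_def) (metis abs_mult_self_eq mult_1 zero_less_one)
    have zB: "z \<notin> B" using v by (auto simp: B_def)
    have "connected (C - {q})"
    proof (cases "q \<in> C")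
      case True then show ?thesis by (rule C_minus)
    qed (simp add: C)
    moreover have "A \<inter> - B \<inter> (C - {q}) = {}" using AB assms by blast
    moreover have "C - {q} \<subseteq> A \<union> - B" using BA assms by blast
    moreover have "A \<inter> (C - {q}) \<noteq> {}" using yA y qA by blast
    moreover have "z \<noteq> q" using zB v y1 s by (auto simp: B_def q_def)
    then have "- B \<inter> (C - {q}) \<noteq> {}" using zB z by blast
    ultimately show False
      using \<open>open A\<close> \<open>closed B\<close> unfolding connected_def by (metis open_Compl)
  qed
  have "f ` C = sphere 0 1" using hom by (auto simp: homeomorphism_def)
  moreover have "(1::complex) \<in> sphere 0 1" "(-1::complex) \<in> sphere 0 1" by auto
  ultimately obtain y z where yz: "y \<in> C" "z \<in> C" "f y = 1" "f z = -1" by (metis imageE)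
  then have "y \<noteq> z" by auto
  then have ex: "\<exists>n. y n \<noteq> z n" by auto
  define n where "n = (LEAST n. y n \<noteq> z n)"
  have n: "y n \<noteq> z n" using ex unfolding n_def by (rule LeastI_ex)
  have pre: "y i = z i" if "i < n" for i using not_less_Least that unfolding n_def by blast
  \<comment> \<open>Either the larger entry is positive or the smaller one is negative. The point
    with that entry lies beyond the cut and takes the place of \<open>y\<close> in
    \<open>sep\<close>.\<close>
  have sep': False if "y n < z n" "y \<in> C" "z \<in> C" "\<And>i. i < n \<Longrightarrow> y i = z i" for y z
  proof (cases "0 < z n")
    case True
    then have "max 0 (y n) < z n" using that(1) by simp
    then obtain v where "max 0 (y n) < v" "v < z n" using dense by blast
    then show False using sep[of z y n 1 v] that by auto
  next
    case False
    then have "max 0 (- z n) < - y n" using that(1) by simp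
    then obtain v where "max 0 (- z n) < v" "v < - y n" using dense by blast
    then show False using sep[of y z n "-1" v] that by auto
  qed
  show False using sep'[of y z] sep'[of z y] n pre yz(1,2) by fastforce
qed

section \<open>The metric\<close>

lemma dist_fun_summable:
  fixes x y :: "nat \<Rightarrow> real"
  shows "summable (\<lambda>n. (1/2)^n * min (dist (x (from_nat n)) (y (from_nat n))) 1)"
  by (rule summable_comparison_test'[of "\<lambda>n. (1/2)^n"]) (auto simp: summable_geometric_iff)

lemma dist_fun_le_2:
  fixes x y :: "nat \<Rightarrow> real"
  shows "dist x y \<le> 2"
proof -
  have "dist x y \<le> (\<Sum>n. (1/2)^n :: real)"
    unfolding dist_fun_def
    by (intro suminf_le dist_fun_summable) (auto simp: summable_geometric_iff)
  then show ?thesis using suminf_geometric[of "1/2::real"] by simp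
qed

lemma dist_fun_ge:
  fixes x y :: "nat \<Rightarrow> real"
  shows "(1/2) ^ to_nat n * min \<bar>x n - y n\<bar> 1 \<le> dist x y"
  unfolding dist_fun_def
  using sum_le_suminf[OF dist_fun_summable, of "{to_nat n}" x y]
  by (simp add: dist_real_def)

text \<open>The type class distance is at most \<open>2\<close>, so the second summand makes \<open>rho\<close> at least \<open>4\<close> when the
  entries with index \<open>1\<close> have opposite signs, and stay within \<open>2\<close> when they agree.\<close>

definition rho :: "(nat \<Rightarrow> real) \<Rightarrow> (nat \<Rightarrow> real) \<Rightarrow> real" where
  "rho y z = dist y z + 2 * \<bar>y 1 - z 1\<bar>"

lemma Metric_space_rho: "Metric_space Y rho"
proof
  show "0 \<le> rho x y" for x y by (simp add: rho_def)
  show "rho x y = rho y x" for x y by (simp add: rho_def dist_commute abs_minus_commute)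
  show "rho x y = 0 \<longleftrightarrow> x = y" for x y
    using zero_le_dist[of x y] by (auto simp: rho_def add_nonneg_eq_0_iff)
  show "rho x z \<le> rho x y + rho y z" for x y z
    using dist_triangle[of x z y] by (simp add: rho_def abs_if)
qed

text \<open>Distances from a fixed point under \<open>rho\<close> are continuous for the product
  topology, and \<open>rho\<close> dominates \<open>dist\<close>; so each topology refines the
  other.\<close>

lemma mtopology_rho: "Metric_space.mtopology Y rho = top_of_set Y"
proof -
  interpret Metric_space Y rho by (rule Metric_space_rho)
  show ?thesis
  proof (rule topology_eq[THEN iffD2], rule allI, rule iffI)
    fix U assume U: "openin mtopology U"
    show "openin (top_of_set Y) U"
      unfolding openin_contains_ball
    proof (intro conjI ballI)
      show "U \<subseteq> Y" using U openin_mtopology by blast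
      fix x assume "x \<in> U"
      then obtain r where r: "r > 0" "mball x r \<subseteq> U" and "x \<in> Y"
        using U unfolding openin_mtopology by blast
      have "open {y. rho x y < r}" unfolding rho_def
        by (intro open_Collect_less continuous_intros continuous_on_product_coordinates)
      moreover have "x \<in> {y. rho x y < r}" using r by (simp add: rho_def)
      ultimately obtain e where "e > 0" "ball x e \<subseteq> {y. rho x y < r}"
        using open_contains_ball by blast
      then show "\<exists>e>0. ball x e \<inter> Y \<subseteq> U"
        using r \<open>x \<in> Y\<close> by (intro exI[of _ e]) (auto simp: subset_iff)
    qed
  next
    fix U assume U: "openin (top_of_set Y) U"
    show "openin mtopology U"
      unfolding openin_mtopology
    proof (intro conjI allI impI)
      show "U \<subseteq> Y" using U openin_imp_subset by blast
      fix x assume "x \<in> U"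
      then obtain e where "e > 0" "ball x e \<inter> Y \<subseteq> U"
        using U unfolding openin_contains_ball by blast
      moreover have "dist x y \<le> rho x y" for y by (simp add: rho_def)
      ultimately show "\<exists>r>0. mball x r \<subseteq> U"
        by (intro exI[of _ e]) (force simp: subset_iff intro: le_less_trans)
    qed
  qed
qed

lemma homeomorphic_space_top_of_set:
  assumes "top_of_set S homeomorphic_space top_of_set T"
  shows "S homeomorphic T"
proof -
  obtain f g where fg: "homeomorphic_maps (top_of_set S) (top_of_set T) f g"
    using assms unfolding homeomorphic_space_def by blast
  have "homeomorphism S T f g"
    by (rule homeomorphismI) (use fg in \<open>auto simp: homeomorphic_maps_def\<close>)
  then show ?thesis unfolding homeomorphic_def by blast
qed

lemma dendrite_downclosed:
  assumes "downclosed Y" "compact Y" "Y \<noteq> {}"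
  shows "dendrite Y rho"
  unfolding dendrite_def continuum_def mtopology_rho
proof (intro conjI)
  show "Metric_space Y rho" by (rule Metric_space_rho)
  show "compact_space (top_of_set Y)" using assms(2) by (simp add: compact_space_subtopology)
  show "connected_space (top_of_set Y)"
    using connected_downclosed[OF assms(1)] by (simp add: connected_space_subtopology)
  show "locally_connected_space (top_of_set Y)"
    using locally_connected_downclosed[OF assms(1)] .
  show "\<not> (\<exists>C\<subseteq>Y. subtopology (top_of_set Y) C homeomorphic_space top_of_set (sphere (0::complex) 1))"
  proof (intro notI, elim exE conjE)
    fix C assume C: "C \<subseteq> Y"
      and hom: "subtopology (top_of_set Y) C homeomorphic_space top_of_set (sphere (0::complex) 1)"
    have "subtopology (top_of_set Y) C = top_of_set C"
      using C by (simp add: subtopology_subtopology inf.absorb2)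
    then have "C homeomorphic sphere (0::complex) 1"
      using hom homeomorphic_space_top_of_set by auto
    moreover have "C \<subseteq> tree" using C assms(1) by (auto simp: downclosed_def)
    ultimately show False using no_circle_in_tree by blast
  qed
qed (rule assms(3))

section \<open>The map and its endpoint system\<close>

text \<open>On \<open>full\<close> the factor is 1, so even entries stay fixed. On all of
  \<open>tree\<close> it gives \<open>step y k\<close> the absolute value of
  \<open>y (k + 2)\<close>, as for odd \<open>k\<close>; this keeps the image in
  \<open>tree\<close>.\<close>

definition step :: "(nat \<Rightarrow> real) \<Rightarrow> nat \<Rightarrow> real" where
  "step y k = (if even k then y k * \<bar>y (k + 2)\<bar> else y (k + 2))"

definition full :: "(nat \<Rightarrow> real) set" where
  "full = {x. \<forall>i. \<bar>x i\<bar> = 1}"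

lemma continuous_on_step: "continuous_on S step"
proof -
  have "continuous_on UNIV (\<lambda>y::nat \<Rightarrow> real. step y k)" for k
    unfolding step_def
    by (cases "even k") (auto intro!: continuous_intros continuous_on_product_coordinates)
  then have "continuous_on UNIV step"
    by (rule continuous_on_coordinatewise_then_product)
  then show ?thesis using continuous_on_subset by blast
qed

lemma step_in_tree:
  assumes "y \<in> tree"
  shows "step y \<in> tree"
proof -
  have "\<bar>step y k\<bar> = \<bar>y (k + 2)\<bar>" for k
    using tree_less[OF assms, of "k + 2" k] by (auto simp: step_def abs_mult)
  moreover have "step y k \<noteq> 0 \<Longrightarrow> y (k + 2) \<noteq> 0" for k by (auto simp: step_def split: if_splits)
  ultimately show ?thesis using assms by (auto simp: tree_def)
qed

text \<open>Monotonicity carries the invariance of \<open>ends\<close> over to their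
  truncations.\<close>

lemma step_below:
  assumes "below y x"
  shows "below (step y) (step x)"
proof -
  have b: "0 \<le> y i * x i" "\<bar>y i\<bar> \<le> \<bar>x i\<bar>" for i using assms by (auto simp: below_def)
  \<comment> \<open>With \<open>i + 2\<close> for \<open>j\<close>, this is the comparison of the
    even entries of the two images.\<close>
  have "0 \<le> (y i * x i) * (\<bar>y j\<bar> * \<bar>x j\<bar>)" "\<bar>y i\<bar> * \<bar>y j\<bar> \<le> \<bar>x i\<bar> * \<bar>x j\<bar>" for i j
    using b by (auto intro!: mult_nonneg_nonneg mult_mono)
  then show ?thesis using b by (auto simp: below_def step_def abs_mult ac_simps)
qed

lemma step_full: "x \<in> full \<Longrightarrow> step x \<in> full"
  by (auto simp: full_def step_def abs_mult)

lemma funpow_step_full: "x \<in> full \<Longrightarrow> (step ^^ i) x \<in> full"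
  by (induction i) (auto intro: step_full)

lemma funpow_step_even: "x \<in> full \<Longrightarrow> (step ^^ i) x (2 * k) = x (2 * k)"
  using funpow_step_full[of x] by (induction i) (auto simp: step_def full_def)

lemma funpow_step_odd: "(step ^^ i) x (2 * k + 1) = x (2 * (k + i) + 1)"
proof (induction i arbitrary: k)
  case (Suc i)
  show ?case using Suc[of "Suc k"] by (simp add: step_def)
qed simp

lemma funpow_step_eq_0:
  assumes "\<And>k. n \<le> k \<Longrightarrow> y k = 0" "n \<le> i"
  shows "(step ^^ i) y = (\<lambda>_. 0)"
proof -
  have "(step ^^ i) y k = 0" if "n \<le> k + 2 * i" for i k
    using that by (induction i arbitrary: k) (auto simp: assms(1) step_def)
  then show ?thesis using assms(2) by (intro ext) auto
qed

lemma tree_not_full: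
  assumes "y \<in> tree" "y \<notin> full"
  obtains n where "\<And>k. n \<le> k \<Longrightarrow> y k = 0"
proof -
  obtain m where "\<bar>y m\<bar> \<noteq> 1" using assms(2) by (auto simp: full_def)
  then have "y k = 0" if "Suc m \<le> k" for k
    using tree_less[OF assms(1), of k m] that by fastforce
  then show ?thesis using that by blast
qed

lemma full_subset_tree: "full \<subseteq> tree"
  by (auto simp: full_def tree_def)

lemma closed_full: "closed full"
proof -
  have "full = (\<Inter>i. {x. \<bar>x i\<bar> = 1})" by (auto simp: full_def)
  moreover have "closed (\<Inter>i::nat. {x. \<bar>x i\<bar> = (1::real)})"
    by (intro closed_INT ballI closed_Collect_eq continuous_intros continuous_on_product_coordinates)
  ultimately show ?thesis by metis
qed

text \<open>Full points are maximal in the tree order, so closing \<open>ends\<close> downwards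
  creates no new full points.\<close>

lemma below_full:
  assumes "below y x" "y \<in> full" "x \<in> full"
  shows "y = x"
proof
  fix i
  have "0 \<le> y i * x i" "\<bar>y i\<bar> = 1" "\<bar>x i\<bar> = 1" using assms by (auto simp: below_def full_def)
  then show "y i = x i" by (auto simp: abs_if split: if_splits)
qed

section \<open>Blocks, words and the set of endpoints\<close>

text \<open>The numbering is shifted by one: \<open>block 0 = 0\<close>, and the times in
  \<open>{4^j..<4^Suc j}\<close> form block \<open>Suc j\<close>.\<close>

definition block :: "nat \<Rightarrow> nat" where
  "block t = (LEAST j. t < 4 ^ j)"

lemma less_block: "t < 4 ^ block t"
proof -
  have "t < 2 ^ t" by (rule less_exp)
  also have "(2::nat) ^ t \<le> 4 ^ t" by (rule power_mono) auto
  finally have "t < 4 ^ t" .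
  then show ?thesis unfolding block_def by (rule LeastI)
qed

lemma block_le: "t < 4 ^ j \<Longrightarrow> block t \<le> j"
  unfolding block_def by (rule Least_le)

lemma block_eq:
  assumes "4 ^ j \<le> t" "t < 4 ^ Suc j"
  shows "block t = Suc j"
proof -
  have "4 ^ j < (4::nat) ^ block t" using less_block[of t] assms(1) by linarith
  then have "j < block t" by (rule power_less_imp_less_exp[rotated]) simp
  then show ?thesis using block_le[OF assms(2)] by linarith
qed

lemma block_Suc_neq:
  assumes "block (Suc t) \<noteq> block t"
  shows "\<exists>j. Suc t = 4 ^ j"
proof (rule ccontr)
  assume "\<nexists>j. Suc t = 4 ^ j"
  then have "Suc t < 4 ^ block t" using less_block[of t] by (metis Suc_lessI)
  then have "block (Suc t) \<le> block t" by (rule block_le)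
  moreover have "block t \<le> block (Suc t)" using less_block[of "Suc t"] by (intro block_le) simp
  ultimately show False using assms by simp
qed

text \<open>Only even entries of \<open>x\<close> are read, and \<open>step\<close> fixes these on
  \<open>full\<close>, so the word is the same along an orbit there. The first component of
  \<open>prod_decode\<close> takes each value infinitely often, hence every even entry returns in
  infinitely many odd blocks.\<close>

definition word :: "(nat \<Rightarrow> real) \<Rightarrow> nat \<Rightarrow> real" where
  "word x t = (if even (block t) then 1 else x (2 * fst (prod_decode (block t div 2))))"

definition follows_word :: "nat \<Rightarrow> (nat \<Rightarrow> real) set" where
  "follows_word n = {x. \<forall>i. x (2 * i + 1) = word x (n + i)}"

text \<open>The restriction to a finite window lets late shifts of a word belong to the set,
  although a whole word can switch infinitely often.\<close>

definition one_switch :: "nat \<Rightarrow> (nat \<Rightarrow> real) set" where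
  "one_switch L = {x. \<forall>q<L. \<forall>p<q. x (2 * p + 1) = x (2 * p + 3) \<or> x (2 * q + 1) = x (2 * q + 3)}"

definition ends :: "(nat \<Rightarrow> real) set" where
  "ends = full \<inter> ((\<Inter>L. one_switch L) \<union> (\<Union>n. follows_word n))"

definition down_ends :: "(nat \<Rightarrow> real) set" where
  "down_ends = {y \<in> tree. \<exists>x\<in>ends. below y x}"

text \<open>A change after position \<open>p\<close> forces \<open>n + p + 1\<close> to be a power
  of 4. If \<open>q\<close> is the position of a later change, then \<open>n + q + 1\<close> is at
  least four times as large, which puts \<open>q\<close> beyond \<open>3 * n\<close> and so outside
  the window.\<close>

lemma follows_word_one_switch:
  assumes "L \<le> n"
  shows "follows_word n \<subseteq> one_switch L"
proof
  fix x assume x: "x \<in> follows_word n"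
  have sw: "\<exists>j. n + p + 1 = 4 ^ j" if "x (2 * p + 1) \<noteq> x (2 * p + 3)" for p
  proof -
    have "x (2 * p + 1) = word x (n + p)" "x (2 * Suc p + 1) = word x (n + Suc p)"
      using x unfolding follows_word_def by blast+
    then have "word x (n + p) \<noteq> word x (Suc (n + p))" using that by (simp add: numeral_eq_Suc)
    then have "block (Suc (n + p)) \<noteq> block (n + p)" unfolding word_def by metis
    then show ?thesis using block_Suc_neq[of "n + p"] by simp
  qed
  show "x \<in> one_switch L"
    unfolding one_switch_def
  proof (intro CollectI allI impI, rule ccontr)
    fix p q assume "q < L" "p < q"
      "\<not> (x (2 * p + 1) = x (2 * p + 3) \<or> x (2 * q + 1) = x (2 * q + 3))"
    then obtain j j' where j: "n + p + 1 = 4 ^ j" "n + q + 1 = 4 ^ j'" using sw by meson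
    then have "(4::nat) ^ j < 4 ^ j'" using \<open>p < q\<close> by linarith
    then have "j < j'" by (rule power_less_imp_less_exp[rotated]) simp
    then have "(4::nat) ^ Suc j \<le> 4 ^ j'" by (intro power_increasing) auto
    then have "4 * (n + p + 1) \<le> n + q + 1" using j by simp
    then show False using assms \<open>q < L\<close> by simp
  qed
qed

text \<open>An infinite union of closed sets need not be closed, but for each \<open>L\<close> all
  but finitely many of the sets \<open>follows_word n\<close> lie in
  \<open>one_switch L\<close>.\<close>

lemma closed_ends: "closed ends"
proof -
  \<comment> \<open>a locally finite form of the infinite union in the definition\<close>
  have eq: "ends = full \<inter> (\<Inter>L. one_switch L \<union> (\<Union>n\<in>{..<L}. follows_word n))"
    (is "_ = full \<inter> ?R")
  proof -
    have "(\<Inter>L. one_switch L) \<union> (\<Union>n. follows_word n) = ?R"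
    proof (intro equalityI subsetI INT_I)
      fix x L assume "x \<in> (\<Inter>L. one_switch L) \<union> (\<Union>n. follows_word n)"
      then consider "x \<in> one_switch L" | n where "x \<in> follows_word n" by blast
      then show "x \<in> one_switch L \<union> (\<Union>n\<in>{..<L}. follows_word n)"
      proof cases
        case (2 n)
        then show ?thesis using follows_word_one_switch[of L n] by (cases "n < L") auto
      qed simp
    qed auto
    then show ?thesis by (simp add: ends_def)
  qed
  have 1: "closed (one_switch L)" for L
  proof -
    have "one_switch L = (\<Inter>q\<in>{..<L}. \<Inter>p\<in>{..<q}. {x. x (2 * p + 1) = x (2 * p + 3)} \<union> {x. x (2 * q + 1) = x (2 * q + 3)})"
      by (auto simp: one_switch_def)
    also have "closed \<dots>"
      by (intro closed_INT ballI closed_Un closed_Collect_eq continuous_on_product_coordinates)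
    finally show ?thesis .
  qed
  have 2: "closed (follows_word n)" for n
  proof -
    have "follows_word n = (\<Inter>i. {x. x (2 * i + 1) = word x (n + i)})"
      by (auto simp: follows_word_def)
    also have "closed \<dots>"
    proof (intro closed_INT ballI closed_Collect_eq continuous_on_product_coordinates)
      show "continuous_on UNIV (\<lambda>x. word x (n + i))" for i
        by (cases "even (block (n + i))") (simp_all add: word_def)
    qed
    finally show ?thesis .
  qed
  show ?thesis
    unfolding eq by (intro closed_Int closed_full closed_INT ballI closed_Un closed_UN finite_lessThan 1 2)
qed

lemma word_cong: "(\<And>k. x (2 * k) = y (2 * k)) \<Longrightarrow> word x t = word y t"
  by (simp add: word_def)

text \<open>The odd part loses its first entry while the word stays the same: a shift by
  \<open>n\<close> becomes one by \<open>Suc n\<close>, and a window of length \<open>Suc L\<close>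
  shrinks to \<open>L\<close>.\<close>

lemma step_in_ends:
  assumes "x \<in> ends"
  shows "step x \<in> ends"
proof -
  have x: "x \<in> full" using assms by (simp add: ends_def)
  have even: "step x (2 * k) = x (2 * k)" for k using x by (simp add: step_def full_def)
  have "step x \<in> follows_word (Suc n)" if "x \<in> follows_word n" for n
  proof -
    have "word (step x) t = word x t" for t by (rule word_cong) (rule even)
    moreover have "x (2 * Suc i + 1) = word x (n + Suc i)" for i
      using that unfolding follows_word_def by blast
    ultimately show ?thesis by (simp add: follows_word_def step_def)
  qed
  moreover have "step x \<in> one_switch L" if "x \<in> one_switch (Suc L)" for L
    unfolding one_switch_def
  proof (intro CollectI allI impI)
    fix p q assume "q < L" "p < q"
    then have "x (2 * Suc p + 1) = x (2 * Suc p + 3) \<or> x (2 * Suc q + 1) = x (2 * Suc q + 3)"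
      using that unfolding one_switch_def by blast
    then show "step x (2 * p + 1) = step x (2 * p + 3) \<or> step x (2 * q + 1) = step x (2 * q + 3)"
      by (simp add: step_def)
  qed
  ultimately show ?thesis
    using assms step_full[OF x] by (auto simp: ends_def)
qed

lemma step_in_down_ends: "y \<in> down_ends \<Longrightarrow> step y \<in> down_ends"
  unfolding down_ends_def using step_in_tree step_below step_in_ends by blast

lemma downclosed_down_ends: "downclosed down_ends"
  unfolding downclosed_def down_ends_def using below_trans by blast

lemma ends_subset_down_ends: "ends \<subseteq> down_ends"
  using full_subset_tree below_refl by (auto simp: down_ends_def ends_def)

lemma full_down_ends: "y \<in> down_ends \<Longrightarrow> y \<in> full \<Longrightarrow> y \<in> ends"
  using below_full by (auto simp: down_ends_def ends_def)

text \<open>The set is the first projection of a compact set of pairs, because \<open>below\<close>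
  is a closed relation.\<close>

lemma compact_down_ends: "compact down_ends"
proof -
  define R where "R = (tree \<times> ends) \<inter> {(y, x). below y x}"
  have fc: "continuous_on UNIV (\<lambda>p::(nat \<Rightarrow> real) \<times> (nat \<Rightarrow> real). fst p i)"
    "continuous_on UNIV (\<lambda>p::(nat \<Rightarrow> real) \<times> (nat \<Rightarrow> real). snd p i)" for i
    by (intro continuous_on_product_then_coordinatewise[OF continuous_on_fst[OF continuous_on_id]]
        continuous_on_product_then_coordinatewise[OF continuous_on_snd[OF continuous_on_id]])+
  have "closed {(y, x). below y x}"
  proof -
    have "{(y, x). below y x} = (\<Inter>i. {p. 0 \<le> fst p i * snd p i} \<inter> {p. \<bar>fst p i\<bar> \<le> \<bar>snd p i\<bar>})"
      by (auto simp: below_def)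
    also have "closed \<dots>"
      by (intro closed_INT ballI closed_Int closed_Collect_le continuous_intros fc)
    finally show ?thesis .
  qed
  moreover have "compact ends"
    using compact_tree closed_ends full_subset_tree
    by (metis compact_Int_closed ends_def inf.absorb_iff2 le_infI1)
  ultimately have "compact R"
    unfolding R_def using compact_tree by (intro compact_Int_closed compact_Times)
  then have "compact (fst ` R)"
    by (intro compact_continuous_image continuous_intros)
  moreover have "fst ` R = down_ends" by (force simp: R_def down_ends_def)
  ultimately show ?thesis by simp
qed

section \<open>Li-Yorke and DC3 pairs\<close>

lemma at_most_one_switch:
  fixes u :: "nat \<Rightarrow> 'a"
  assumes "\<And>p q. p < q \<Longrightarrow> u p = u (Suc p) \<or> u q = u (Suc q)"
  shows "\<exists>p. \<forall>i. u i = (if i \<le> p then u 0 else u (Suc p))"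
proof (cases "\<exists>p. u p \<noteq> u (Suc p)")
  case True
  then obtain p where p: "u p \<noteq> u (Suc p)" "\<And>i. i < p \<Longrightarrow> u i = u (Suc i)"
    using exists_least_iff[of "\<lambda>p. u p \<noteq> u (Suc p)"] by auto
  have "i \<le> p \<Longrightarrow> u i = u 0" for i
    by (induction i) (use p(2) in \<open>auto simp: Suc_le_eq\<close>)
  moreover have "u (Suc p + j) = u (Suc p)" for j
  proof (induction j)
    case (Suc j)
    then show ?case using assms[of p "Suc p + j"] p(1) by simp
  qed simp
  then have "u i = u (Suc p)" if "p < i" for i
    using that by (metis Suc_leI le_add_diff_inverse)
  ultimately show ?thesis by (metis not_le)
next
  case False
  then have "u i = u 0" for i by (induction i) auto
  then show ?thesis by metis
qed

text \<open>Once the even entries are fixed, countable data determine the odd part: the number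
  \<open>n\<close> of a shift (set \<open>P\<close>), or two signs and the position of the switch
  (set \<open>Q\<close>).\<close>

lemma countable_fibre:
  "countable {x \<in> ends. \<forall>k. x (2 * k) = c (2 * k)}"
proof -
  define glue where "glue = (\<lambda>u k. if even k then c k else u (k div 2) :: real)"
  have glue: "x = glue u" if "\<forall>k. x (2 * k) = c (2 * k)" "\<And>i. x (2 * i + 1) = u i" for x u
  proof
    fix k show "x k = glue u k"
      using that by (cases "even k") (auto simp: glue_def elim!: evenE oddE)
  qed
  define P where "P = range (\<lambda>n. glue (\<lambda>i. word c (n + i)))"
  define h where "h = (\<lambda>(a, b, p::nat). glue (\<lambda>i. if i \<le> p then a else b))"
  define Q where "Q = h ` ({1, -1} \<times> {1, -1} \<times> UNIV)"
  have "x \<in> P \<union> Q" if x: "x \<in> ends" "\<forall>k. x (2 * k) = c (2 * k)" for x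
  proof -
    have "x \<in> P" if "x \<in> follows_word n" for n
    proof -
      have "word x t = word c t" for t using x(2) by (intro word_cong) simp
      then have "x = glue (\<lambda>i. word c (n + i))"
        using that x(2) by (intro glue) (auto simp: follows_word_def)
      then show ?thesis by (auto simp: P_def)
    qed
    moreover have "x \<in> Q" if sw: "\<And>L. x \<in> one_switch L"
    proof -
      have pm: "x k \<in> {1, -1}" for k
        using x(1) by (auto simp: ends_def full_def abs_if split: if_splits)
      have "\<exists>p. \<forall>i. x (2 * i + 1) = (if i \<le> p then x (2 * 0 + 1) else x (2 * Suc p + 1))"
      proof (rule at_most_one_switch)
        fix p q :: nat assume "p < q"
        then have "x (2 * p + 1) = x (2 * p + 3) \<or> x (2 * q + 1) = x (2 * q + 3)"
          using sw[of "Suc q"] unfolding one_switch_def by blast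
        then show "x (2 * p + 1) = x (2 * Suc p + 1) \<or> x (2 * q + 1) = x (2 * Suc q + 1)"
          by (simp add: numeral_3_eq_3)
      qed
      then obtain p where "\<And>i. x (2 * i + 1) = (if i \<le> p then x (2 * 0 + 1) else x (2 * Suc p + 1))"
        by blast
      then have "x = h (x (2 * 0 + 1), x (2 * Suc p + 1), p)"
        unfolding h_def prod.case using x(2) by (intro glue)
      moreover have "(x (2 * 0 + 1), x (2 * Suc p + 1), p) \<in> {1, -1} \<times> {1, -1} \<times> UNIV"
        using pm by auto
      ultimately show ?thesis unfolding Q_def by blast
    qed
    ultimately show ?thesis using x(1) by (auto simp: ends_def)
  qed
  then have "{x \<in> ends. \<forall>k. x (2 * k) = c (2 * k)} \<subseteq> P \<union> Q" by (intro subsetI) simp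
  moreover have "countable (P \<union> Q)"
    unfolding P_def Q_def by (intro countable_Un countable_image countable_SIGMA) auto
  ultimately show ?thesis by (rule countable_subset)
qed

text \<open>A difference in an even entry persists along the orbits and keeps the distance above the
  weight of that coordinate, so the lower limit could not be 0.\<close>

lemma li_yorke_pair_full:
  assumes x: "x \<in> full" and y: "y \<in> full" and ly: "li_yorke_pair rho step x y"
  shows "x (2 * k) = y (2 * k)"
proof (rule ccontr)
  assume ne: "x (2 * k) \<noteq> y (2 * k)"
  let ?d = "(1/2) ^ to_nat (2 * k) :: real"
  have "\<bar>x (2 * k)\<bar> = 1" "\<bar>y (2 * k)\<bar> = 1" using x y by (auto simp: full_def)
  then have "\<bar>x (2 * k) - y (2 * k)\<bar> \<ge> 1" using ne by linarith
  moreover have "(step ^^ i) x (2 * k) = x (2 * k)" "(step ^^ i) y (2 * k) = y (2 * k)" for i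
    using x y by (simp_all only: funpow_step_even)
  ultimately have "min \<bar>(step ^^ i) x (2 * k) - (step ^^ i) y (2 * k)\<bar> 1 = 1" for i by simp
  then have "?d \<le> dist ((step ^^ i) x) ((step ^^ i) y)" for i
    using dist_fun_ge[of "2 * k" "(step ^^ i) x" "(step ^^ i) y"] by simp
  then have "?d \<le> rho ((step ^^ i) x) ((step ^^ i) y)" for i
    unfolding rho_def by (intro order_trans[OF _ add_increasing2]) auto
  then have "ereal ?d \<le> liminf (\<lambda>i. ereal (rho ((step ^^ i) x) ((step ^^ i) y)))"
    by (intro Liminf_bounded) simp
  then have "ereal ?d \<le> 0" using ly by (simp only: li_yorke_pair_def)
  then have "?d \<le> 0" by simp
  moreover have "0 < ?d" by simp
  ultimately show False by linarith
qed

lemma not_li_yorke_pair_not_full: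
  assumes "x \<in> tree - full" "y \<in> tree - full"
  shows "\<not> li_yorke_pair rho step x y"
proof -
  obtain m n where "\<And>k. m \<le> k \<Longrightarrow> x k = 0" "\<And>k. n \<le> k \<Longrightarrow> y k = 0"
    using assms tree_not_full by (metis DiffD1 DiffD2)
  then have "rho ((step ^^ i) x) ((step ^^ i) y) = 0" if "max m n \<le> i" for i
    using that funpow_step_eq_0[of m x i] funpow_step_eq_0[of n y i] by (simp add: rho_def)
  then have "\<forall>\<^sub>F i in sequentially. ereal (rho ((step ^^ i) x) ((step ^^ i) y)) = 0"
    unfolding eventually_sequentially by (metis zero_ereal_def)
  then have "limsup (\<lambda>i. ereal (rho ((step ^^ i) x) ((step ^^ i) y))) = limsup (\<lambda>i. 0)"
    by (rule Limsup_eq)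
  then show ?thesis by (simp add: li_yorke_pair_def Limsup_const)
qed

text \<open>Two points outside \<open>full\<close> eventually meet at the root, so a scrambled set
  contains at most one such point. Its full points all share their even entries and thus lie in a
  single countable fibre.\<close>

lemma not_li_yorke_chaotic_down_ends: "\<not> li_yorke_chaotic down_ends rho step"
proof
  assume "li_yorke_chaotic down_ends rho step"
  then obtain S where S: "uncountable S" "S \<subseteq> down_ends"
    and ly: "\<And>x y. x \<in> S \<Longrightarrow> y \<in> S \<Longrightarrow> x \<noteq> y \<Longrightarrow> li_yorke_pair rho step x y"
    unfolding li_yorke_chaotic_def li_yorke_scrambled_def by (elim exE conjE) simp
  have "S \<subseteq> tree" using S(2) by (auto simp: down_ends_def)
  then have "x = y" if "x \<in> S - full" "y \<in> S - full" for x y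
    using that ly not_li_yorke_pair_not_full by blast
  then have "S - full \<subseteq> {x}" if "x \<in> S - full" for x using that by blast
  then have "countable (S - full)"
    by (metis all_not_in_conv countable_empty countable_insert countable_subset)
  then have unc: "uncountable (S \<inter> full)"
    using S(1) by (metis Int_Diff_Un countable_Un)
  then obtain c where c: "c \<in> S \<inter> full" by (metis countable_empty ex_in_conv)
  have "S \<inter> full \<subseteq> {x \<in> ends. \<forall>k. x (2 * k) = c (2 * k)}"
    using S(2) full_down_ends ly li_yorke_pair_full c by blast
  then show False using unc countable_fibre countable_subset by blast
qed

section \<open>DC3 pairs and an uncountable DC3 scrambled set\<close>

lemma DC3_pair_follows_word:
  assumes x: "x \<in> full \<inter> follows_word 0" and y: "y \<in> full \<inter> follows_word 0"
    and ne: "x (2 * a) \<noteq> y (2 * a)"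
  shows "DC3_pair rho step x y"
proof -
  define A where "A = {i. word x i = word y i}"
  \<comment> \<open>If the words agree at time \<open>i\<close>, the distance is at most 2,
    otherwise at least 4. Every threshold from 3 to 4 therefore yields the same frequencies, those
    of agreement of the two words.\<close>
  have close: "rho ((step ^^ i) x) ((step ^^ i) y) < s \<longleftrightarrow> i \<in> A" if "s \<in> {3..4}" for i s
  proof -
    have "(step ^^ i) x 1 = word x i" "(step ^^ i) y 1 = word y i"
      using x y funpow_step_odd[of i _ 0] by (auto simp: follows_word_def)
    moreover have "\<bar>word x i\<bar> = 1" "\<bar>word y i\<bar> = 1" using x y by (auto simp: word_def full_def)
    ultimately have "rho ((step ^^ i) x) ((step ^^ i) y)
        = dist ((step ^^ i) x) ((step ^^ i) y) + (if i \<in> A then 0 else 4)"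
      by (auto simp: rho_def A_def abs_if split: if_splits)
    moreover have "0 \<le> dist ((step ^^ i) x) ((step ^^ i) y)" "dist ((step ^^ i) x) ((step ^^ i) y) \<le> 2"
      by (simp_all add: dist_fun_le_2)
    moreover have "3 \<le> s" "s \<le> 4" using that by auto
    ultimately show ?thesis
      by (smt (verit))
  qed
  define f where "f n = 1 / real n * real (card {i. i \<le> n \<and> i \<in> A})" for n
  have up: "\<exists>n\<ge>N. f n \<ge> 3/4" for N
  proof -
    \<comment> \<open>The block that ends just before \<open>n\<close> has the even number
      \<open>2 * N + 2\<close>, so both words are 1 on it; it fills three quarters of the time up to
      \<open>n\<close>.\<close>
    define n where "n = (4::nat) ^ (2 * N + 2)"
    have "{4 ^ (2 * N + 1)..<n} \<subseteq> {i. i \<le> n \<and> i \<in> A}"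
    proof
      fix i assume i: "i \<in> {4 ^ (2 * N + 1)..<n}"
      then have "block i = Suc (2 * N + 1)" by (intro block_eq) (auto simp: n_def)
      then show "i \<in> {i. i \<le> n \<and> i \<in> A}" using i by (auto simp: A_def word_def)
    qed
    from card_mono[OF _ this] have "3 * 4 ^ (2 * N + 1) \<le> card {i. i \<le> n \<and> i \<in> A}"
      by (simp add: n_def)
    then have "3 * n \<le> 4 * card {i. i \<le> n \<and> i \<in> A}" by (simp add: n_def)
    then have "3 * real n \<le> 4 * real (card {i. i \<le> n \<and> i \<in> A})" by linarith
    moreover have "n > 0" by (simp add: n_def)
    ultimately have "f n \<ge> 3/4" by (simp add: f_def field_simps)
    moreover have "N \<le> n"
    proof -
      have "N < 2 ^ N" by (rule less_exp)
      also have "(2::nat) ^ N \<le> 4 ^ N" by (rule power_mono) auto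
      also have "(4::nat) ^ N \<le> n" unfolding n_def by (rule power_increasing) auto
      finally show ?thesis by simp
    qed
    ultimately show ?thesis by blast
  qed
  have down: "\<exists>n\<ge>N. f n \<le> 1/2" for N
  proof -
    \<comment> \<open>Block \<open>Suc j\<close> is odd and both words read entry
      \<open>2 * a\<close> on it. The component \<open>N\<close> only serves to make
      \<open>j\<close> large.\<close>
    define j where "j = 2 * prod_encode (a, N)"
    define n where "n = (4::nat) ^ Suc j"
    \<comment> \<open>The count includes time \<open>n\<close> itself, which belongs to the next
      block. This extra 1 is absorbed by aiming at 1/2 instead of 1/4.\<close>
    have "{i. i \<le> n \<and> i \<in> A} \<subseteq> insert n {..<4 ^ j}"
    proof
      fix i assume i: "i \<in> {i. i \<le> n \<and> i \<in> A}"
      have "i \<notin> A" if "4 ^ j \<le> i" "i < n"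
      proof -
        have "block i = Suc j" using that by (intro block_eq) (auto simp: n_def)
        then have "word x i = x (2 * a)" "word y i = y (2 * a)" by (auto simp: word_def j_def)
        then show ?thesis using ne by (simp add: A_def)
      qed
      then show "i \<in> insert n {..<4 ^ j}" using i by force
    qed
    from card_mono[OF _ this] have "card {i. i \<le> n \<and> i \<in> A} \<le> 4 ^ j + 1"
      by (simp add: card_insert_if n_def split: if_splits)
    moreover have "(4::nat) ^ j \<ge> 1" by simp
    ultimately have "2 * card {i. i \<le> n \<and> i \<in> A} \<le> n" unfolding n_def power_Suc by linarith
    then have "2 * real (card {i. i \<le> n \<and> i \<in> A}) \<le> real n" by linarith
    moreover have "n > 0" by (simp add: n_def)
    ultimately have "f n \<le> 1/2" by (simp add: f_def field_simps)
    moreover have "N \<le> n"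
    proof -
      have "N \<le> j" using le_prod_encode_2[of N a] by (simp add: j_def)
      also have "j < 2 ^ j" by (rule less_exp)
      also have "(2::nat) ^ j \<le> 4 ^ j" by (rule power_mono) auto
      finally show ?thesis by (simp add: n_def)
    qed
    ultimately show ?thesis by blast
  qed
  have "liminf (\<lambda>n. ereal (f n)) \<le> ereal (1/2)"
  proof (rule ccontr)
    assume "\<not> ?thesis"
    then have "\<forall>\<^sub>F n in sequentially. ereal (1/2) < ereal (f n)"
      by (intro less_LiminfD) simp
    then obtain N where "\<And>n. N \<le> n \<Longrightarrow> 1/2 < f n"
      by (auto simp: eventually_sequentially)
    then show False using down[of N] by force
  qed
  also have "ereal (1/2) < ereal (3/4)" by simp
  also have "ereal (3/4) \<le> limsup (\<lambda>n. ereal (f n))"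
  proof (rule ccontr)
    assume "\<not> ?thesis"
    then have "\<forall>\<^sub>F n in sequentially. ereal (f n) < ereal (3/4)"
      by (intro Limsup_lessD) simp
    then obtain N where "\<And>n. N \<le> n \<Longrightarrow> f n < 3/4"
      by (auto simp: eventually_sequentially)
    then show False using up[of N] by force
  qed
  finally have "liminf (\<lambda>n. ereal (f n)) < limsup (\<lambda>n. ereal (f n))" .
  then have "\<forall>s\<in>{3..4}. lower_distr rho step x y s < upper_distr rho step x y s"
    by (simp add: lower_distr_def upper_distr_def close f_def)
  then show ?thesis unfolding DC3_pair_def by (intro exI[of _ 3] exI[of _ 4]) simp
qed

text \<open>The word is formed from an auxiliary sequence that agrees with \<open>start A\<close> at
  even indices, the only ones that \<open>word\<close> reads. This avoids a recursive
  definition.\<close>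

definition start :: "nat set \<Rightarrow> nat \<Rightarrow> real" where
  "start A k = (if even k then if k div 2 \<in> A then 1 else -1
     else word (\<lambda>j. if j div 2 \<in> A then 1 else -1) (k div 2))"

lemma start_in: "start A \<in> full \<inter> follows_word 0"
proof
  show "start A \<in> full" by (simp add: full_def start_def word_def)
  have "start A (2 * i + 1) = word (start A) (0 + i)" for i
    by (simp add: start_def word_def)
  then show "start A \<in> follows_word 0" unfolding follows_word_def by blast
qed

lemma start_even: "start A (2 * a) = (if a \<in> A then 1 else -1)"
  by (simp add: start_def)

lemma DC3_chaotic_down_ends: "DC3_chaotic down_ends rho step"
  unfolding DC3_chaotic_def DC3_scrambled_def
proof (intro exI conjI ballI impI)
  have "inj start"
  proof (rule injI)
    fix A B assume eq: "start A = start B"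
    show "A = B"
    proof (rule set_eqI)
      fix a show "a \<in> A \<longleftrightarrow> a \<in> B"
        using start_even[of A a] start_even[of B a] unfolding eq by (simp split: if_splits)
    qed
  qed
  moreover have "uncountable (UNIV :: nat set set)"
    using Cantors_theorem[of "UNIV::nat set"] by (auto simp: uncountable_def)
  ultimately show "uncountable (range start)"
    using countable_image_inj_on[of start UNIV] by blast
  show "range start \<subseteq> down_ends"
    using start_in ends_subset_down_ends by (auto simp: ends_def)
  fix x y assume "x \<in> range start" "y \<in> range start" "x \<noteq> y"
  then obtain A B where AB: "x = start A" "y = start B" "A \<noteq> B" by blast
  then obtain a where "a \<in> A \<longleftrightarrow> a \<notin> B" by blast
  then have "start A (2 * a) \<noteq> start B (2 * a)" by (auto simp: start_even)
  then show "DC3_pair rho step x y"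
    unfolding AB by (rule DC3_pair_follows_word[OF start_in start_in])
qed

theorem theoremC:
  "\<exists>(Y :: (nat \<Rightarrow> real) set) \<rho> F.
     dendrite Y \<rho> \<and> dynamical_system Y \<rho> F \<and> DC3_chaotic Y \<rho> F \<and> \<not> li_yorke_chaotic Y \<rho> F"
proof (intro exI conjI)
  have "start {} \<in> down_ends" using start_in ends_subset_down_ends by (auto simp: ends_def)
  then show "dendrite down_ends rho"
    using dendrite_downclosed[OF downclosed_down_ends compact_down_ends] by blast
  have "continuous_map (top_of_set down_ends) (top_of_set down_ends) step"
    using continuous_on_step step_in_down_ends by (auto simp: continuous_map_in_subtopology)
  then show "dynamical_system down_ends rho step"
    unfolding dynamical_system_def mtopology_rho
    using Metric_space_rho compact_down_ends by (simp add: compact_space_subtopology)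
qed (rule DC3_chaotic_down_ends not_li_yorke_chaotic_down_ends)+

end
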